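(* For any entire function $f:\mathbb{C}\to\mathbb{C}$ the trace function $T(f)$ satisfies the following system of partial differential equations on $\mathbb{C}^k$: $$(\partial_p\partial_q-\partial_{p+i}\partial_{q-i})[T(f)]=0\quad\text{for all integers }p,q,i\text{ such that }p,q,p+i,q-i\in[1,k],$$ $$\mathcal{T}^m[T(f)]=0\quad\text{with}\quad\mathcal{T}^m:=\partial_1\partial_{m-1}+\Big(\sum_{h=1}^k\sigma_h\partial_h\Big)\partial_m+\partial_m,\quad\text{for all }m\in[2,k].$$
   Context: Let $k$ be a positive integer; $\mathbb{C}^k$ has coordinates $\sigma=(\sigma_1,\dots,\sigma_k)$, $\partial_h=\frac{\partial}{\partial\sigma_h}$, and $[a,b]$ denotes the set of integers from $a$ to $b$. For an entire function $f$ on $\mathbb{C}$, $T(f)$ is the entire function on $\mathbb{C}^k$ defined by $T(f)(\sigma)=\sum_{j=1}^kf(x_j)$, where $x_1,\dots,x_k$ are the roots, counted with multiplicity, of $P_\sigma(z)=z^k+\sum_{h=1}^k(-1)^h\sigma_hz^{k-h}$. *)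

theory Defs
  imports "HOL-Complex_Analysis.Complex_Analysis" "HOL-Computational_Algebra.Computational_Algebra"
begin

text \<open>
  A point of \<open>\<complex>\<^sup>k\<close> is given by a function \<open>\<sigma> :: nat \<Rightarrow> complex\<close>, of which only the
  coordinates \<open>\<sigma> 1, \<dots>, \<sigma> k\<close> matter: \<open>trace_fun k f\<close> ignores the other values, and so
  do its partial derivatives.
\<close>

definition partial :: "nat \<Rightarrow> ((nat \<Rightarrow> complex) \<Rightarrow> complex) \<Rightarrow> (nat \<Rightarrow> complex) \<Rightarrow> complex" where
  "partial h g \<sigma> = deriv (\<lambda>z. g (\<sigma>(h := z))) (\<sigma> h)"

definition sym_poly :: "nat \<Rightarrow> (nat \<Rightarrow> complex) \<Rightarrow> complex poly" where
  "sym_poly k \<sigma> = monom 1 k + (\<Sum>h=1..k. monom ((-1) ^ h * \<sigma> h) (k - h))"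

lemma poly_sym_poly:
  "poly (sym_poly k \<sigma>) z = z ^ k + (\<Sum>h=1..k. (-1) ^ h * \<sigma> h * z ^ (k - h))"
  by (simp add: sym_poly_def poly_monom poly_sum)

text \<open>
  For entire \<open>f\<close> and \<open>k \<ge> 1\<close> the function \<open>trace_fun k f\<close> is entire in \<open>\<sigma> 1, \<dots>, \<sigma> k\<close>, so the
  total operator \<open>deriv\<close> in \<open>partial\<close> gives its true complex partial derivatives.
  \<open>proots\<close> is the multiset of roots, each with its multiplicity.
\<close>

definition trace_fun :: "nat \<Rightarrow> (complex \<Rightarrow> complex) \<Rightarrow> (nat \<Rightarrow> complex) \<Rightarrow> complex" where
  "trace_fun k f \<sigma> = (\<Sum>x\<in>#proots (sym_poly k \<sigma>). f x)"

definition trace_op ::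
  "nat \<Rightarrow> nat \<Rightarrow> ((nat \<Rightarrow> complex) \<Rightarrow> complex) \<Rightarrow> (nat \<Rightarrow> complex) \<Rightarrow> complex" where
  "trace_op k m g \<sigma> =
     partial 1 (partial (m - 1) g) \<sigma>
     + (\<Sum>h=1..k. \<sigma> h * partial h (partial m g) \<sigma>)
     + partial m g \<sigma>"

end

theory Submission
  imports Defs
begin

text \<open>
  The trace is a contour integral of rational expressions in \<open>\<sigma>\<close>. On a circle \<open>|z| = R\<close> that
  encloses all roots of \<open>P = P\<^sub>\<sigma>\<close>, Cauchy's integral formula gives
  \<open>2\<pi>\<i> T(f)(\<sigma>) = \<integral> f P' / P dz\<close> (\<open>trace_fun_contour_integral\<close>). Put
  \<open>c\<^sub>h(z) = (-1)\<^sup>h z\<^bsup>k-h\<^esup>\<close>, the derivative of \<open>P\<close> with respect to \<open>\<sigma>\<^sub>h\<close>. Differentiation with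
  respect to \<open>\<sigma>\<^sub>h\<close> turns the logarithmic derivative \<open>P'/P\<close> into the exact derivative
  \<open>(c\<^sub>h / P)'\<close>, so integration by parts yields
  \<open>2\<pi>\<i> \<partial>\<^sub>h T(f) = - \<integral> f' c\<^sub>h / P dz\<close> (\<open>partial_trace_fun\<close>), and one more differentiation yields
  \<open>2\<pi>\<i> \<partial>\<^sub>p \<partial>\<^sub>q T(f) = \<integral> f' c\<^sub>p c\<^sub>q / P\<^sup>2 dz\<close> (\<open>partial_partial_trace_fun\<close>).

  Both families of equations now hold already for the integrands. The product \<open>c\<^sub>p c\<^sub>q\<close> depends on
  \<open>p + q\<close> only, which is the first family. For the second one, \<open>c\<^sub>1 c\<^bsub>m-1\<^esub> = c\<^sub>m z\<^sup>k\<close> and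
  \<open>z\<^sup>k + \<Sum> \<sigma>\<^sub>h c\<^sub>h = P\<close>, so the two second-order terms add up to \<open>f' c\<^sub>m / P\<close>, the
  negative of the integrand of \<open>\<partial>\<^sub>m T(f)\<close>.
\<close>

section \<open>Contour integrals over a circle\<close>

text \<open>
  Cauchy's integral formula summed over the roots: the logarithmic derivative of a product of
  linear factors is the sum of the simple poles \<open>1 / (z - x)\<close>.
\<close>

lemma has_contour_integral_log_deriv_prod_linear:
  fixes f :: "complex \<Rightarrow> complex"
  assumes f: "f holomorphic_on UNIV" and M: "\<forall>x\<in>#M. norm x < R"
  defines "p \<equiv> \<lambda>M. \<Prod>x\<in>#M. [:-x, 1:]"
  shows "((\<lambda>z. f z * poly (pderiv (p M)) z / poly (p M) z)
           has_contour_integral (2 * of_real pi * \<i> * (\<Sum>x\<in>#M. f x))) (circlepath 0 R)"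
  using M
proof (induction M)
  case empty
  show ?case by (simp add: p_def pderiv_1 has_contour_integral_0)
next
  case (add x M)
  have R: "norm x < R" "0 < R"
    using add.prems norm_ge_zero[of x] by (auto simp del: norm_ge_zero)
  have "((\<lambda>z. f z / (z - x)) has_contour_integral (2 * of_real pi * \<i> * f x)) (circlepath 0 R)"
    using R f by (intro Cauchy_integral_circlepath_simple) (auto intro: holomorphic_on_subset)
  from has_contour_integral_add[OF this add.IH] add.prems
  have "((\<lambda>z. f z / (z - x) + f z * poly (pderiv (p M)) z / poly (p M) z)
          has_contour_integral (2 * of_real pi * \<i> * (\<Sum>x\<in>#add_mset x M. f x))) (circlepath 0 R)"
    by (simp add: algebra_simps)
  then show ?case
  proof (rule has_contour_integral_eq)
    fix z assume "z \<in> path_image (circlepath 0 R)"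
    then have z: "norm z = R" using R by simp
    have nz: "z \<noteq> x" "poly (p M) z \<noteq> 0"
      using z add.prems by (auto simp: p_def poly_prod_mset prod_mset_zero_iff)
    have p: "p (add_mset x M) = [:-x, 1:] * p M" by (simp add: p_def)
    have "pderiv (p (add_mset x M)) = p M + [:-x, 1:] * pderiv (p M)"
      unfolding p pderiv_mult by (simp add: pderiv_pCons add.commute)
    then have deriv: "poly (pderiv (p (add_mset x M))) z = poly (p M) z + (z - x) * poly (pderiv (p M)) z"
      by (simp only: poly_add poly_mult) (simp add: algebra_simps)
    have val: "poly (p (add_mset x M)) z = (z - x) * poly (p M) z"
      unfolding p by (simp add: algebra_simps)
    show "f z / (z - x) + f z * poly (pderiv (p M)) z / poly (p M) z
        = f z * poly (pderiv (p (add_mset x M))) z / poly (p (add_mset x M)) z"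
      unfolding deriv val using nz by (simp add: field_simps)
  qed
qed

lemma has_contour_integral_log_deriv_poly:
  fixes f :: "complex \<Rightarrow> complex" and p :: "complex poly"
  assumes f: "f holomorphic_on UNIV" and "p \<noteq> 0"
    and roots: "\<And>x. poly p x = 0 \<Longrightarrow> norm x < R"
  shows "((\<lambda>z. f z * poly (pderiv p) z / poly p z)
           has_contour_integral (2 * of_real pi * \<i> * (\<Sum>x\<in>#proots p. f x))) (circlepath 0 R)"
proof -
  define q where "q = (\<Prod>x\<in>#proots p. [:-x, 1:])"
  have p: "p = smult (lead_coeff p) q"
    unfolding q_def by (rule complex_poly_decompose_multiset[symmetric])
  have "poly (pderiv p) z / poly p z = poly (pderiv q) z / poly q z" for z
    using \<open>p \<noteq> 0\<close> by (subst (1 2) p) (simp add: pderiv_smult)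
  then have eq: "(\<lambda>z. f z * poly (pderiv p) z / poly p z) = (\<lambda>z. f z * poly (pderiv q) z / poly q z)"
    by (metis times_divide_eq_right)
  show ?thesis
    unfolding eq q_def using assms
    by (intro has_contour_integral_log_deriv_prod_linear) auto
qed

text \<open>
  The Leibniz rule on the parameter interval of the circle, where the contour integral is an
  ordinary integral.
\<close>

lemma has_field_derivative_contour_integral_circlepath:
  fixes F F' :: "complex \<Rightarrow> complex \<Rightarrow> complex"
  assumes U: "open U" "convex U" "s0 \<in> U" and R: "0 \<le> R"
    and der: "\<And>s z. s \<in> U \<Longrightarrow> norm z = R \<Longrightarrow> ((\<lambda>s. F s z) has_field_derivative F' s z) (at s)"
    and cont: "\<And>s. s \<in> U \<Longrightarrow> continuous_on (sphere 0 R) (F s)"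
    and cont': "continuous_on (U \<times> sphere 0 R) (\<lambda>(s, z). F' s z)"
  shows "((\<lambda>s. contour_integral (circlepath 0 R) (F s)) has_field_derivative
           contour_integral (circlepath 0 R) (F' s0)) (at s0)"
proof -
  let ?c = "circlepath 0 R"
  let ?v = "\<lambda>t. 2 * pi * \<i> * R * exp (2 * of_real pi * \<i> * of_real t)"
  have c: "norm (?c t) = R" for t
    using R by (simp add: circlepath norm_mult norm_exp_eq_Re)
  have cc: "continuous_on A ?c" for A
    unfolding circlepath by (intro continuous_intros)
  have "((\<lambda>s. integral (cbox 0 1) (\<lambda>t. F s (?c t) * ?v t)) has_field_derivative
           integral (cbox 0 1) (\<lambda>t. F' s0 (?c t) * ?v t)) (at s0 within U)"
  proof (rule leibniz_rule_field_derivative)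
    show "((\<lambda>s. F s (?c t) * ?v t) has_field_derivative F' s (?c t) * ?v t) (at s within U)"
      if "s \<in> U" for s t
      using DERIV_cmult_right[OF der[OF that c, of t], of "?v t"]
      by (rule has_field_derivative_at_within)
    show "(\<lambda>t. F s (?c t) * ?v t) integrable_on cbox 0 1" if "s \<in> U" for s
      by (intro integrable_continuous continuous_intros continuous_on_compose2[OF cont[OF that] cc])
         (use c in auto)
    have "continuous_on (U \<times> cbox 0 1) (\<lambda>x. ?c (snd x))"
      by (intro continuous_on_compose2[OF cc continuous_on_snd[OF continuous_on_id]]) auto
    then have "continuous_on (U \<times> cbox 0 1) (\<lambda>x. (\<lambda>(s, z). F' s z) (fst x, ?c (snd x)))"
      by (intro continuous_on_compose2[OF cont'] continuous_intros) (use c in auto)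
    then have "continuous_on (U \<times> cbox 0 1) (\<lambda>x. F' (fst x) (?c (snd x)) * ?v (snd x))"
      by (intro continuous_intros) simp_all
    then show "continuous_on (U \<times> cbox 0 1) (\<lambda>(s, t). F' s (?c t) * ?v t)"
      by (simp add: split_beta)
  qed (use U in auto)
  then show ?thesis
    unfolding at_within_open[OF U(3,1)] contour_integral_integral vector_derivative_circlepath
      cbox_interval .
qed

section \<open>The polynomial with prescribed elementary symmetric functions\<close>

text \<open>
  The derivative of \<open>P\<^sub>\<sigma>(z)\<close> with respect to the coordinate \<open>\<sigma>\<^sub>h\<close>, written \<open>c\<^sub>h(z)\<close> in the
  comments. For \<open>h = 0\<close> it is the leading power \<open>z\<^sup>k\<close>.
\<close>

definition coeff_deriv :: "nat \<Rightarrow> nat \<Rightarrow> complex \<Rightarrow> complex" where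
  "coeff_deriv k h z = (-1) ^ h * z ^ (k - h)"

definition root_bound :: "nat \<Rightarrow> (nat \<Rightarrow> complex) \<Rightarrow> real" where
  "root_bound k \<sigma> = 1 + (\<Sum>h=1..k. norm (\<sigma> h))"

lemma poly_sym_poly_coeff_deriv:
  "poly (sym_poly k \<sigma>) z = z ^ k + (\<Sum>h=1..k. \<sigma> h * coeff_deriv k h z)"
  by (simp add: poly_sym_poly coeff_deriv_def mult_ac)

lemma sym_poly_nonzero: "sym_poly k \<sigma> \<noteq> 0"
proof -
  have "coeff (sym_poly k \<sigma>) k = 1 + (\<Sum>h=1..k. coeff (monom ((-1) ^ h * \<sigma> h) (k - h)) k)"
    by (simp add: sym_poly_def coeff_sum)
  also have "(\<Sum>h=1..k. coeff (monom ((-1) ^ h * \<sigma> h) (k - h)) k) = 0"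
    by (intro sum.neutral) auto
  finally show ?thesis by auto
qed

lemma sym_poly_upd:
  assumes "h \<in> {1..k}"
  shows "sym_poly k (\<sigma>(h := s)) = sym_poly k \<sigma> + smult (s - \<sigma> h) (monom ((-1) ^ h) (k - h))"
proof -
  have "(\<Sum>i=1..k. monom ((-1) ^ i * (\<sigma>(h := s)) i) (k - i))
      = (\<Sum>i=1..k. monom ((-1) ^ i * \<sigma> i) (k - i)
          + (if i = h then smult (s - \<sigma> h) (monom ((-1) ^ h) (k - h)) else 0))"
    by (intro sum.cong) (auto simp: smult_monom add_monom algebra_simps)
  then show ?thesis
    using assms by (simp add: sym_poly_def sum.distrib)
qed

lemma poly_sym_poly_upd:
  assumes "h \<in> {1..k}"
  shows "poly (sym_poly k (\<sigma>(h := s))) z = poly (sym_poly k \<sigma>) z + (s - \<sigma> h) * coeff_deriv k h z"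
  by (simp add: sym_poly_upd[OF assms] coeff_deriv_def poly_monom)

lemma root_bound_ge_1: "root_bound k \<sigma> \<ge> 1"
  by (simp add: root_bound_def sum_nonneg)

text \<open>
  At a root with \<open>|z| \<ge> 1\<close> every term \<open>\<sigma>\<^sub>h z\<^bsup>k-h\<^esup>\<close> is at most \<open>|\<sigma>\<^sub>h| |z|\<^bsup>k-1\<^esup>\<close> in absolute value,
  and comparison with \<open>|z|\<^sup>k\<close> bounds \<open>|z|\<close> by \<open>\<Sum> |\<sigma>\<^sub>h|\<close>.
\<close>

lemma norm_root_sym_poly_less:
  assumes root: "poly (sym_poly k \<sigma>) z = 0"
  shows "norm z < root_bound k \<sigma>"
proof (rule ccontr)
  define S where "S = (\<Sum>h=1..k. norm (\<sigma> h))"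
  assume "\<not> norm z < root_bound k \<sigma>"
  then have z: "1 + S \<le> norm z" by (simp add: root_bound_def S_def)
  have z1: "1 \<le> norm z" using z by (simp add: S_def) (smt (verit) norm_ge_zero sum_nonneg)
  show False
  proof (cases k)
    case 0
    then show False using root by (simp add: poly_sym_poly)
  next
    case (Suc n)
    have "z ^ k = - (\<Sum>h=1..k. (-1) ^ h * \<sigma> h * z ^ (k - h))"
      using root by (simp add: poly_sym_poly eq_neg_iff_add_eq_0)
    then have "norm z ^ k = norm (\<Sum>h=1..k. (-1) ^ h * \<sigma> h * z ^ (k - h))"
      by (metis norm_minus_cancel norm_power)
    also have "\<dots> \<le> (\<Sum>h=1..k. norm (\<sigma> h) * norm z ^ n)"
    proof (rule order.trans[OF norm_sum sum_mono])
      fix h assume "h \<in> {1..k}"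
      then have "k - h \<le> n" using Suc by auto
      then show "norm ((-1) ^ h * \<sigma> h * z ^ (k - h)) \<le> norm (\<sigma> h) * norm z ^ n"
        using z1 by (auto simp: norm_mult norm_power intro!: mult_left_mono power_increasing)
    qed
    also have "\<dots> = S * norm z ^ n" by (simp add: S_def sum_distrib_right)
    finally have "norm z * norm z ^ n \<le> S * norm z ^ n" using Suc by simp
    moreover have "norm z ^ n > 0" using z1 by (intro zero_less_power) linarith
    ultimately have "norm z \<le> S" by simp
    then show False using z by linarith
  qed
qed

lemma root_bound_upd:
  "root_bound k (\<sigma>(h := s)) \<le> root_bound k \<sigma> + norm (s - \<sigma> h)"
proof -
  have "(\<Sum>i=1..k. norm ((\<sigma>(h := s)) i)) \<le>
        (\<Sum>i=1..k. norm (\<sigma> i) + (if i = h then norm (s - \<sigma> h) else 0))"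
    using norm_triangle_sub[of s "\<sigma> h"] by (intro sum_mono) auto
  also have "\<dots> \<le> (\<Sum>i=1..k. norm (\<sigma> i)) + norm (s - \<sigma> h)"
    by (simp add: sum.distrib)
  finally show ?thesis by (simp add: root_bound_def)
qed

text \<open>
  The circle \<open>|z| = R\<close> still encloses all roots when one coordinate moves in this disc, which
  makes the contour independent of the variable of differentiation.
\<close>

lemma root_bound_upd_less:
  assumes "s \<in> ball (\<sigma> h) (R - root_bound k \<sigma>)"
  shows "root_bound k (\<sigma>(h := s)) < R"
  using assms root_bound_upd[of k \<sigma> h s] by (simp add: dist_norm norm_minus_commute)

lemma sym_poly_nonzero_on_circle:
  assumes "root_bound k \<sigma> < R" "norm z = R"
  shows "poly (sym_poly k \<sigma>) z \<noteq> 0"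
  using norm_root_sym_poly_less[of k \<sigma> z] assms by auto

lemma coeff_deriv_mult_cong:
  assumes "p \<le> k" "q \<le> k" "p' \<le> k" "q' \<le> k" "p + q = p' + q'"
  shows "coeff_deriv k p z * coeff_deriv k q z = coeff_deriv k p' z * coeff_deriv k q' z"
proof -
  have "coeff_deriv k p z * coeff_deriv k q z = (-1) ^ (p + q) * z ^ ((k - p) + (k - q))" for p q
    by (simp add: coeff_deriv_def power_add)
  moreover have "(k - p) + (k - q) = (k - p') + (k - q')" using assms by linarith
  ultimately show ?thesis using assms(5) by metis
qed

section \<open>Integral formulas for the trace and its derivatives\<close>

lemma trace_fun_contour_integral:
  assumes "f holomorphic_on UNIV" "root_bound k \<sigma> < R"
  shows "((\<lambda>z. f z * poly (pderiv (sym_poly k \<sigma>)) z / poly (sym_poly k \<sigma>) z)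
           has_contour_integral (2 * of_real pi * \<i> * trace_fun k f \<sigma>)) (circlepath 0 R)"
  unfolding trace_fun_def
  using assms norm_root_sym_poly_less
  by (intro has_contour_integral_log_deriv_poly) (auto simp: sym_poly_nonzero intro: less_trans)

text \<open>
  Both integrands to be differentiated, \<open>f P' / P\<close> and \<open>- f' c\<^sub>h / P\<close>, have numerator and
  denominator affine in each coordinate, with a denominator that vanishes nowhere on the circle.
\<close>

lemma has_field_derivative_contour_integral_affine_quotient:
  fixes g n0 n1 d0 d1 :: "complex \<Rightarrow> complex"
  assumes r: "0 < r" and R: "0 \<le> R"
    and nz: "\<And>s z. s \<in> ball a r \<Longrightarrow> norm z = R \<Longrightarrow> d0 z + (s - a) * d1 z \<noteq> 0"
    and cont: "continuous_on (sphere 0 R) g"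
      "continuous_on (sphere 0 R) n0" "continuous_on (sphere 0 R) n1"
      "continuous_on (sphere 0 R) d0" "continuous_on (sphere 0 R) d1"
  shows "((\<lambda>s. contour_integral (circlepath 0 R)
             (\<lambda>z. g z * (n0 z + (s - a) * n1 z) / (d0 z + (s - a) * d1 z)))
          has_field_derivative contour_integral (circlepath 0 R)
             (\<lambda>z. g z * (n1 z * d0 z - n0 z * d1 z) / d0 z ^ 2)) (at a)"
proof -
  let ?U = "ball a r"
  let ?D = "\<lambda>s z. d0 z + (s - a) * d1 z"
  define F' where "F' = (\<lambda>s z. g z * (n1 z * ?D s z - (n0 z + (s - a) * n1 z) * d1 z) / (?D s z) ^ 2)"
  have snd: "continuous_on (?U \<times> sphere 0 R) (\<lambda>x. h (snd x))"
    if "continuous_on (sphere 0 R) h" for h :: "complex \<Rightarrow> complex"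
    by (rule continuous_on_compose2[OF that continuous_on_snd[OF continuous_on_id]]) auto
  have "((\<lambda>s. contour_integral (circlepath 0 R) (\<lambda>z. g z * (n0 z + (s - a) * n1 z) / ?D s z))
          has_field_derivative contour_integral (circlepath 0 R) (F' a)) (at a)"
  proof (rule has_field_derivative_contour_integral_circlepath[of ?U])
    show "((\<lambda>s. g z * (n0 z + (s - a) * n1 z) / ?D s z) has_field_derivative F' s z) (at s)"
      if "s \<in> ?U" "norm z = R" for s z
      unfolding F'_def using nz[OF that]
      by (auto intro!: derivative_eq_intros simp: power2_eq_square algebra_simps)
    show "continuous_on (sphere 0 R) (\<lambda>z. g z * (n0 z + (s - a) * n1 z) / ?D s z)" if "s \<in> ?U" for s
      using nz[OF that] by (intro continuous_intros cont) auto
    have "continuous_on (?U \<times> sphere 0 R) (\<lambda>x. F' (fst x) (snd x))"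
      unfolding F'_def using nz by (intro continuous_intros snd cont) auto
    then show "continuous_on (?U \<times> sphere 0 R) (\<lambda>(s, z). F' s z)"
      by (simp add: split_beta)
  qed (use r R in auto)
  then show ?thesis by (simp add: F'_def)
qed

text \<open>
  By the quotient rule the derivative of \<open>P' / P\<close> in \<open>\<sigma>\<^sub>h\<close> is \<open>(c\<^sub>h' P - P' c\<^sub>h) / P\<^sup>2\<close>, which is also
  the derivative of \<open>c\<^sub>h / P\<close> in \<open>z\<close>. Integration by parts moves that derivative to \<open>f\<close>, so
  that only \<open>P\<close> is left to differentiate in the next step.
\<close>

lemma partial_trace_fun:
  assumes f: "f holomorphic_on UNIV" and h: "h \<in> {1..k}" and R: "root_bound k \<sigma> < R"
  shows "((\<lambda>z. - (deriv f z * coeff_deriv k h z / poly (sym_poly k \<sigma>) z))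
           has_contour_integral (2 * of_real pi * \<i> * partial h (trace_fun k f) \<sigma>)) (circlepath 0 R)"
proof -
  let ?P = "sym_poly k \<sigma>" and ?m = "monom ((-1) ^ h) (k - h) :: complex poly"
  let ?r = "R - root_bound k \<sigma>"
  let ?C = "2 * of_real pi * \<i> :: complex"
  let ?by_parts = "\<lambda>z. f z * (poly (pderiv ?m) z * poly ?P z - poly (pderiv ?P) z * poly ?m z) / poly ?P z ^ 2"
  have R0: "0 \<le> R" "0 < R" using R root_bound_ge_1[of k \<sigma>] by linarith+
  have m: "coeff_deriv k h z = poly ?m z" for z by (simp add: coeff_deriv_def poly_monom)
  have nz: "poly ?P z \<noteq> 0" if "norm z = R" for z
    by (rule sym_poly_nonzero_on_circle[OF R that])
  have df: "(f has_field_derivative deriv f z) (at z)" for z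
    using f by (simp add: holomorphic_derivI[of f UNIV])
  have "((\<lambda>s. contour_integral (circlepath 0 R)
              (\<lambda>z. f z * (poly (pderiv ?P) z + (s - \<sigma> h) * poly (pderiv ?m) z)
                    / (poly ?P z + (s - \<sigma> h) * poly ?m z)))
          has_field_derivative contour_integral (circlepath 0 R) ?by_parts) (at (\<sigma> h))"
  proof (rule has_field_derivative_contour_integral_affine_quotient[of ?r])
    show "poly ?P z + (s - \<sigma> h) * poly ?m z \<noteq> 0" if "s \<in> ball (\<sigma> h) ?r" "norm z = R" for s z
      using sym_poly_nonzero_on_circle[OF root_bound_upd_less[OF that(1)] that(2)]
      by (simp add: poly_sym_poly_upd[OF h] m)
    show "continuous_on (sphere 0 R) f"
      using f by (meson continuous_on_subset holomorphic_on_imp_continuous_on subset_UNIV)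
  qed (use R R0 in \<open>auto intro!: continuous_intros\<close>)
  moreover have "\<forall>\<^sub>F s in nhds (\<sigma> h).
      contour_integral (circlepath 0 R)
              (\<lambda>z. f z * (poly (pderiv ?P) z + (s - \<sigma> h) * poly (pderiv ?m) z)
                    / (poly ?P z + (s - \<sigma> h) * poly ?m z))
      = ?C * trace_fun k f (\<sigma>(h := s))"
  proof (rule eventually_nhds_in_open[THEN eventually_mono, of "ball (\<sigma> h) ?r"])
    fix s assume "s \<in> ball (\<sigma> h) ?r"
    from trace_fun_contour_integral[OF f root_bound_upd_less[OF this], THEN contour_integral_unique]
    show "contour_integral (circlepath 0 R)
              (\<lambda>z. f z * (poly (pderiv ?P) z + (s - \<sigma> h) * poly (pderiv ?m) z)
                    / (poly ?P z + (s - \<sigma> h) * poly ?m z))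
      = ?C * trace_fun k f (\<sigma>(h := s))"
      by (simp add: sym_poly_upd[OF h] pderiv_add pderiv_smult)
  qed (use R in auto)
  ultimately have "((\<lambda>s. ?C * trace_fun k f (\<sigma>(h := s))) has_field_derivative
      contour_integral (circlepath 0 R) ?by_parts) (at (\<sigma> h))"
    by (subst (asm) DERIV_cong_ev) auto
  then have "((\<lambda>s. ?C * trace_fun k f (\<sigma>(h := s)) / ?C) has_field_derivative
      contour_integral (circlepath 0 R) ?by_parts / ?C) (at (\<sigma> h))"
    by (rule DERIV_cdivide)
  then have partial: "?C * partial h (trace_fun k f) \<sigma> = contour_integral (circlepath 0 R) ?by_parts"
    by (simp add: partial_def DERIV_imp_deriv)
  have "continuous_on (sphere 0 R) ?by_parts"
    using nz f by (intro continuous_intros continuous_on_subset[OF holomorphic_on_imp_continuous_on[OF f]]) auto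
  then have int: "(?by_parts has_contour_integral ?C * partial h (trace_fun k f) \<sigma>) (circlepath 0 R)"
    unfolding partial using R0
    by (intro has_contour_integral_integral contour_integrable_continuous_circlepath) auto
  \<comment> \<open>The integral over a closed path of the derivative of \<open>f c\<^sub>h / P\<close> vanishes.\<close>
  have "((\<lambda>z. ?by_parts z + deriv f z * poly ?m z / poly ?P z) has_contour_integral 0) (circlepath 0 R)"
  proof -
    have "((\<lambda>z. f z * poly ?m z / poly ?P z) has_field_derivative
            (?by_parts z + deriv f z * poly ?m z / poly ?P z)) (at z within sphere 0 R)"
      if "z \<in> sphere 0 R" for z
    proof (rule has_field_derivative_at_within)
      show "((\<lambda>z. f z * poly ?m z / poly ?P z) has_field_derivative
            (?by_parts z + deriv f z * poly ?m z / poly ?P z)) (at z)"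
        using nz[of z] that df[of z]
        by (auto intro!: derivative_eq_intros simp: field_simps power2_eq_square)
    qed
    from contour_integral_primitive[OF this, of "circlepath 0 R"] show ?thesis
      using R0 by simp
  qed
  from has_contour_integral_diff[OF int this] have
    "((\<lambda>z. ?by_parts z - (?by_parts z + deriv f z * poly ?m z / poly ?P z)) has_contour_integral
        ?C * partial h (trace_fun k f) \<sigma>) (circlepath 0 R)"
    by simp
  then show ?thesis by (simp add: m)
qed

text \<open>
  The factor \<open>c\<^sub>q\<close> is independent of \<open>\<sigma>\<close>, and the derivative of \<open>- 1 / P\<close> in \<open>\<sigma>\<^sub>p\<close> is
  \<open>c\<^sub>p / P\<^sup>2\<close>. The result is symmetric in \<open>p\<close> and \<open>q\<close> and sees them only through \<open>c\<^sub>p c\<^sub>q\<close>.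
\<close>

lemma partial_partial_trace_fun:
  assumes f: "f holomorphic_on UNIV" and p: "p \<in> {1..k}" and q: "q \<in> {1..k}"
    and R: "root_bound k \<sigma> < R"
  shows "((\<lambda>z. deriv f z * (coeff_deriv k p z * coeff_deriv k q z) / poly (sym_poly k \<sigma>) z ^ 2)
           has_contour_integral (2 * of_real pi * \<i> * partial p (partial q (trace_fun k f)) \<sigma>))
           (circlepath 0 R)"
proof -
  let ?P = "sym_poly k \<sigma>" and ?r = "R - root_bound k \<sigma>"
  let ?C = "2 * of_real pi * \<i> :: complex"
  let ?G = "\<lambda>z. deriv f z * (coeff_deriv k p z * coeff_deriv k q z) / poly ?P z ^ 2"
  let ?F = "\<lambda>s z. deriv f z * (- coeff_deriv k q z + (s - \<sigma> p) * 0) / (poly ?P z + (s - \<sigma> p) * coeff_deriv k p z)"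
  have R0: "0 \<le> R" "0 < R" using R root_bound_ge_1[of k \<sigma>] by linarith+
  have nz: "poly ?P z \<noteq> 0" if "norm z = R" for z
    by (rule sym_poly_nonzero_on_circle[OF R that])
  have cf: "continuous_on A (deriv f)" for A
    using f by (meson continuous_on_subset holomorphic_deriv holomorphic_on_imp_continuous_on open_UNIV subset_UNIV)
  have cc: "continuous_on A (coeff_deriv k h)" for h A
    unfolding coeff_deriv_def by (intro continuous_intros)
  \<comment> \<open>The summand \<open>(s - \<sigma> p) * 0\<close> in \<open>?F\<close> brings the constant numerator into affine form.\<close>
  have "((\<lambda>s. contour_integral (circlepath 0 R) (?F s)) has_field_derivative
          contour_integral (circlepath 0 R)
            (\<lambda>z. deriv f z * (0 * poly ?P z - (- coeff_deriv k q z) * coeff_deriv k p z) / poly ?P z ^ 2)) (at (\<sigma> p))"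
  proof (rule has_field_derivative_contour_integral_affine_quotient[of ?r])
    show "poly ?P z + (s - \<sigma> p) * coeff_deriv k p z \<noteq> 0" if "s \<in> ball (\<sigma> p) ?r" "norm z = R" for s z
      using sym_poly_nonzero_on_circle[OF root_bound_upd_less[OF that(1)] that(2)]
      by (simp add: poly_sym_poly_upd[OF p])
  qed (use R R0 in \<open>auto intro!: continuous_intros cf cc\<close>)
  then have "((\<lambda>s. contour_integral (circlepath 0 R) (?F s)) has_field_derivative
          contour_integral (circlepath 0 R) ?G) (at (\<sigma> p))"
    by (simp add: mult_ac)
  moreover have "\<forall>\<^sub>F s in nhds (\<sigma> p). contour_integral (circlepath 0 R) (?F s)
      = ?C * partial q (trace_fun k f) (\<sigma>(p := s))"
  proof (rule eventually_nhds_in_open[THEN eventually_mono, of "ball (\<sigma> p) ?r"])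
    fix s assume "s \<in> ball (\<sigma> p) ?r"
    from partial_trace_fun[OF f q root_bound_upd_less[OF this], THEN contour_integral_unique]
    show "contour_integral (circlepath 0 R) (?F s) = ?C * partial q (trace_fun k f) (\<sigma>(p := s))"
      by (simp add: poly_sym_poly_upd[OF p])
  qed (use R in auto)
  ultimately have "((\<lambda>s. ?C * partial q (trace_fun k f) (\<sigma>(p := s))) has_field_derivative
      contour_integral (circlepath 0 R) ?G) (at (\<sigma> p))"
    by (subst (asm) DERIV_cong_ev) auto
  then have "((\<lambda>s. ?C * partial q (trace_fun k f) (\<sigma>(p := s)) / ?C) has_field_derivative
      contour_integral (circlepath 0 R) ?G / ?C) (at (\<sigma> p))"
    by (rule DERIV_cdivide)
  then have partial: "?C * partial p (partial q (trace_fun k f)) \<sigma> = contour_integral (circlepath 0 R) ?G"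
    unfolding partial_def[of p] by (simp add: DERIV_imp_deriv)
  have "continuous_on (sphere 0 R) ?G"
    using nz by (intro continuous_intros cf cc) auto
  then show ?thesis
    unfolding partial using R0
    by (intro has_contour_integral_integral contour_integrable_continuous_circlepath) auto
qed

section \<open>The differential equations\<close>

lemma partial_partial_trace_fun_cong:
  assumes f: "f holomorphic_on UNIV"
    and "p \<in> {1..k}" "q \<in> {1..k}" "p' \<in> {1..k}" "q' \<in> {1..k}" "p + q = p' + q'"
  shows "partial p (partial q (trace_fun k f)) \<sigma> = partial p' (partial q' (trace_fun k f)) \<sigma>"
proof -
  have R: "root_bound k \<sigma> < root_bound k \<sigma> + 1" by simp
  have "coeff_deriv k p z * coeff_deriv k q z = coeff_deriv k p' z * coeff_deriv k q' z" for z
    using assms by (intro coeff_deriv_mult_cong) auto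
  from partial_partial_trace_fun[OF f assms(2,3) R, unfolded this]
    partial_partial_trace_fun[OF f assms(4,5) R]
  have "2 * of_real pi * \<i> * partial p (partial q (trace_fun k f)) \<sigma>
      = 2 * of_real pi * \<i> * partial p' (partial q' (trace_fun k f)) \<sigma>"
    by (rule has_contour_integral_unique)
  then show ?thesis by simp
qed

lemma trace_op_trace_fun:
  assumes f: "f holomorphic_on UNIV" and m: "m \<in> {2..k}"
  shows "trace_op k m (trace_fun k f) \<sigma> = 0"
proof -
  define R where "R = root_bound k \<sigma> + 1"
  let ?P = "poly (sym_poly k \<sigma>)" and ?c = "coeff_deriv k"
  let ?C = "2 * of_real pi * \<i> :: complex" and ?T = "trace_fun k f"
  let ?I = "\<lambda>z. deriv f z * (?c 1 z * ?c (m - 1) z) / ?P z ^ 2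
      + (\<Sum>h=1..k. \<sigma> h * (deriv f z * (?c h z * ?c m z) / ?P z ^ 2))
      + - (deriv f z * ?c m z / ?P z)"
  have R: "root_bound k \<sigma> < R" by (simp add: R_def)
  have R0: "0 \<le> R" using R root_bound_ge_1[of k \<sigma>] by linarith
  have "(?I has_contour_integral
      (?C * partial 1 (partial (m - 1) ?T) \<sigma>
       + (\<Sum>h=1..k. \<sigma> h * (?C * partial h (partial m ?T) \<sigma>)) + ?C * partial m ?T \<sigma>)) (circlepath 0 R)"
    using m
    by (intro has_contour_integral_add has_contour_integral_sum has_contour_integral_lmul
        partial_partial_trace_fun[OF f _ _ R] partial_trace_fun[OF f _ R]) auto
  moreover have "(?I has_contour_integral 0) (circlepath 0 R)"
  proof (rule has_contour_integral_is_0)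
    fix z assume "z \<in> path_image (circlepath 0 R)"
    then have nz: "?P z \<noteq> 0" using R R0 by (intro sym_poly_nonzero_on_circle) auto
    have "?c 1 z * ?c (m - 1) z = ?c 0 z * ?c m z"
      using m by (intro coeff_deriv_mult_cong) auto
    then have first: "?c 1 z * ?c (m - 1) z = ?c m z * z ^ k"
      by (simp add: coeff_deriv_def)
    have euler: "(\<Sum>h=1..k. \<sigma> h * (deriv f z * (?c h z * ?c m z) / ?P z ^ 2))
        = deriv f z * ?c m z / ?P z ^ 2 * (\<Sum>h=1..k. \<sigma> h * ?c h z)"
      by (simp add: sum_distrib_left sum_divide_distrib mult_ac)
    have sum_c: "(\<Sum>h=1..k. \<sigma> h * ?c h z) = ?P z - z ^ k"
      by (simp add: poly_sym_poly_coeff_deriv)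
    show "?I z = 0"
      unfolding first euler sum_c using nz by (simp add: field_simps power2_eq_square)
  qed
  ultimately have "?C * partial 1 (partial (m - 1) ?T) \<sigma>
       + (\<Sum>h=1..k. \<sigma> h * (?C * partial h (partial m ?T) \<sigma>)) + ?C * partial m ?T \<sigma> = 0"
    by (rule has_contour_integral_unique)
  then have "?C * trace_op k m ?T \<sigma> = 0"
    by (simp only: trace_op_def distrib_left sum_distrib_left mult.left_commute)
  then show ?thesis by simp
qed

theorem proposition4p1p2:
  fixes k :: nat and f :: "complex \<Rightarrow> complex"
  assumes "k \<ge> 1" and "f holomorphic_on UNIV"
  shows "(\<forall>p q i :: int.
            p \<in> {1..int k} \<longrightarrow> q \<in> {1..int k} \<longrightarrow> p + i \<in> {1..int k} \<longrightarrow> q - i \<in> {1..int k} \<longrightarrow>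
            (\<forall>\<sigma>. partial (nat p) (partial (nat q) (trace_fun k f)) \<sigma>
                 - partial (nat (p + i)) (partial (nat (q - i)) (trace_fun k f)) \<sigma> = 0)) \<and>
         (\<forall>m \<in> {2..k}. \<forall>\<sigma>. trace_op k m (trace_fun k f) \<sigma> = 0)"
proof (intro conjI allI impI ballI)
  fix p q i :: int and \<sigma>
  assume "p \<in> {1..int k}" "q \<in> {1..int k}" "p + i \<in> {1..int k}" "q - i \<in> {1..int k}"
  then have "partial (nat p) (partial (nat q) (trace_fun k f)) \<sigma>
      = partial (nat (p + i)) (partial (nat (q - i)) (trace_fun k f)) \<sigma>"
    by (intro partial_partial_trace_fun_cong assms) auto
  then show "partial (nat p) (partial (nat q) (trace_fun k f)) \<sigma>
      - partial (nat (p + i)) (partial (nat (q - i)) (trace_fun k f)) \<sigma> = 0" by simp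
qed (rule trace_op_trace_fun[OF assms(2)])

end
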